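(* The greedy algorithm described in the context approximates Optimal-Weighted-Lobbying with approximation ratio at most $$\sum_{i=1}^{D_0}\frac1i\;\le\;1+\ln D_0\;\le\;1+\ln\Bigl(n\Bigl\lceil\frac{m+1}{2}\Bigr\rceil\Bigr).$$ That is, for an instance with $m$ voters and $n$ referenda, normalized so that the target vector is $1^n$, with matrix $V\in\{0,1\}^{m\times n}$ and nonnegative rational prices $price(v_1),\ldots,price(v_m)$, the output $X$ of the algorithm is a feasible set of voters and $$\sum_{i\in X}price(v_i)\;\le\;\Bigl(\sum_{i=1}^{D_0}\frac1i\Bigr)\cdot \mathrm{OPT},$$ where $D_0$ is the sum of the initial column deficits and $\mathrm{OPT}$ is the minimum total price of a feasible set of voters.
   Context: **Optimal-Weighted-Lobbying.** An instance consists of a matrix $V\in\{0,1\}^{m\times n}$ whose rows $v_1,\ldots,v_m$ represent voters and whose columns $r_1,\ldots,r_n$ represent referenda, a nonnegative rational price $price(v_i)$ for each voter, and a target vector $x\in\{0,1\}^n$. A set of voters is feasible if, by changing the entries of the rows of these voters, one can obtain a matrix such that for each $j$, column $j$ has a strict majority of ones (respectively, zeros) if and only if $x_j=1$ (respectively, $x_j=0$). The goal is to find a feasible set of voters with minimum total price; $\mathrm{OPT}$ denotes this minimum. Without loss of generality the target vector is $1^n$: if $x_j=0$, flip $x_j$ to one and also flip the zeros and ones in column $r_j$. The algorithm is applied to this normalized instance. **Deficits.** For a column $r_j$ of the (current) matrix, the deficit $d_j\ge 0$ is the minimum number of zeros in that column that need to be flipped to ones so that the column has strictly more ones than zeros.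 $D_0=\sum_{j=1}^n d_j$ is computed for the initial matrix. **Greedy algorithm.** Input: $V$ (target $1^n$) and the prices. Initialize $X=\emptyset$, compute all $d_j$, and set $D=\sum_j d_j$. While $D\neq 0$: let $R$ be the set of columns with $d_j=0$; for each row $v_i$ let $\#_0(v_i|_{R^c})$ be the number of zeros of $v_i$ (in the current matrix) in columns not in $R$; choose a voter $v_i$ minimizing $price(v_i)/\#_0(v_i|_{R^c})$ (interpreted as $+\infty$ if $\#_0(v_i|_{R^c})=0$; ties are broken in any simple way, e.g., smallest $i$); flip all zeros of $v_i$ in columns not in $R$ to ones; add $i$ to $X$; decrease $d_j$ by $1$ for each column $r_j$ in which a zero was flipped; recompute $D=\sum_j d_j$. Output $X$. *)

theory Defs
  imports
    "HOL-Analysis.Analysis"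
    "HOL-Library.Z2"
    "HOL-Library.While_Combinator"
begin

definition num_zeros :: "bit ^ 'k \<Rightarrow> nat" where
  "num_zeros c = card {k. c $ k = 0}"

definition num_ones :: "bit ^ 'k \<Rightarrow> nat" where
  "num_ones c = card {k. c $ k = 1}"

text \<open>
  An instance has a matrix \<open>V :: bit ^ 'n ^ 'm\<close> whose rows (index type \<open>'m\<close>) are the
  voters and whose columns (index type \<open>'n\<close>) are the referenda. The entries in the rows
  of the bribed voters \<open>S\<close> may be changed arbitrarily.
\<close>

definition feasible :: "bit ^ 'n ^ 'm \<Rightarrow> bit ^ 'n \<Rightarrow> 'm set \<Rightarrow> bool" where
  "feasible V x S \<longleftrightarrow>
     (\<exists>W :: bit ^ 'n ^ 'm. (\<forall>i. i \<notin> S \<longrightarrow> row i W = row i V) \<and>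
        (\<forall>j. (num_ones (column j W) > num_zeros (column j W) \<longleftrightarrow> x $ j = 1) \<and>
             (num_zeros (column j W) > num_ones (column j W) \<longleftrightarrow> x $ j = 0)))"

definition total_price :: "('m \<Rightarrow> rat) \<Rightarrow> 'm set \<Rightarrow> rat" where
  "total_price price S = (\<Sum>i\<in>S. price i)"

definition OPT :: "bit ^ 'n ^ 'm \<Rightarrow> bit ^ 'n \<Rightarrow> ('m \<Rightarrow> rat) \<Rightarrow> rat" where
  "OPT V x price = Min (total_price price ` {S. feasible V x S})"

definition set_to_one :: "'k set \<Rightarrow> bit ^ 'k \<Rightarrow> bit ^ 'k" where
  "set_to_one Z c = (\<chi> k. if k \<in> Z then 1 else c $ k)"

definition deficit :: "bit ^ 'k \<Rightarrow> nat" where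
  "deficit c = (LEAST d. \<exists>Z \<subseteq> {k. c $ k = 0}.
     card Z = d \<and> num_ones (set_to_one Z c) > num_zeros (set_to_one Z c))"

definition total_deficit :: "bit ^ 'n ^ 'm \<Rightarrow> nat" where
  "total_deficit V = (\<Sum>j\<in>UNIV. deficit (column j V))"

text \<open>
  The deficits in the state of the greedy algorithm are computed from the matrix only once,
  at the start; afterwards they are decremented.
\<close>

record ('m, 'n) greedy_state =
  current :: "bit ^ 'n ^ 'm"
  chosen :: "'m set"
  deficits :: "'n \<Rightarrow> nat"

definition greedy_init :: "bit ^ 'n ^ 'm \<Rightarrow> ('m, 'n) greedy_state" where
  "greedy_init V =
     \<lparr>current = V, chosen = {}, deficits = (\<lambda>j. deficit (column j V))\<rparr>"

definition remaining :: "('m::finite, 'n::finite) greedy_state \<Rightarrow> nat" where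
  "remaining s = (\<Sum>j\<in>UNIV. deficits s j)"

text \<open>
  The columns \<open>j \<notin> R\<close> in which voter \<open>i\<close> has a zero, where \<open>R\<close> is the set of columns of
  deficit \<open>0\<close>.
\<close>

definition open_zeros :: "('m::finite, 'n::finite) greedy_state \<Rightarrow> 'm \<Rightarrow> 'n set" where
  "open_zeros s i = {j. deficits s j \<noteq> 0 \<and> current s $ i $ j = 0}"

definition price_ratio :: "('m \<Rightarrow> rat) \<Rightarrow> ('m::finite, 'n::finite) greedy_state \<Rightarrow> 'm \<Rightarrow> ereal" where
  "price_ratio price s i =
     (if card (open_zeros s i) = 0 then \<infinity>
      else ereal (real_of_rat (price i) / real (card (open_zeros s i))))"

definition minimizers :: "('m \<Rightarrow> rat) \<Rightarrow> ('m::finite, 'n::finite) greedy_state \<Rightarrow> 'm set" where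
  "minimizers price s = {i. \<forall>i'. price_ratio price s i \<le> price_ratio price s i'}"

definition process_voter :: "'m \<Rightarrow> ('m::finite, 'n::finite) greedy_state \<Rightarrow> ('m, 'n) greedy_state" where
  "process_voter i s =
     \<lparr>current = (\<chi> i'. if i' = i then set_to_one (open_zeros s i) (current s $ i)
                      else current s $ i'),
      chosen = insert i (chosen s),
      deficits = (\<lambda>j. if j \<in> open_zeros s i then deficits s j - 1 else deficits s j)\<rparr>"

text \<open>
  The function \<open>tie\<close> selects, depending on the current state, a voter from the set of
  minimizers. A run never visits a state twice before it ends, so letting \<open>tie\<close> range over
  all such functions covers every way of breaking ties. The result is \<open>None\<close> if the loop
  does not terminate.
\<close>

definition greedy ::
  "(('m::finite, 'n::finite) greedy_state \<Rightarrow> 'm set \<Rightarrow> 'm) \<Rightarrow> ('m \<Rightarrow> rat) \<Rightarrow> bit ^ 'n ^ 'm \<Rightarrow> 'm set option" where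
  "greedy tie price V =
     map_option chosen
       (while_option (\<lambda>s. remaining s \<noteq> 0)
          (\<lambda>s. process_voter (tie s (minimizers price s)) s)
          (greedy_init V))"

end

theory Submission
  imports Defs
begin

text \<open>
  A charging argument as for greedy submodular cover. Let \<open>D\<close> be the total remaining
  deficit at some point of the run and \<open>k\<^sub>i\<close> the number of zeros of voter \<open>i\<close> in columns of
  positive deficit. Voters already bribed have \<open>k\<^sub>i = 0\<close>, and the rows of the others are
  still the original ones, so any feasible set \<open>S\<close> must satisfy \<open>D \<le> (\<Sum>i\<in>S. k\<^sub>i)\<close>. Hence the
  smallest ratio \<open>price i / k\<^sub>i\<close> is at most \<open>price(S) / D\<close>, and the step costs at most
  \<open>k\<^sub>i / D \<le> H(D) - H(D - k\<^sub>i)\<close> times \<open>price(S)\<close>, where \<open>H\<close> denotes the harmonic numbers.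
  These bounds telescope over the run to \<open>H(D\<^sub>0)\<close>.
\<close>

section \<open>Majorities and deficits of a single column\<close>

lemma num_zeros_plus_num_ones: "num_zeros c + num_ones c = CARD('k)" for c :: "bit ^ 'k"
proof -
  have "{k. c $ k = 1} = - {k. c $ k = 0}"
    by auto
  then show ?thesis
    unfolding num_zeros_def num_ones_def
    using card_Un_disjoint[of "{k. c $ k = 0}" "- {k. c $ k = 0}"] by simp
qed

lemma majority_iff: "num_zeros c < num_ones c \<longleftrightarrow> CARD('k) div 2 + 1 \<le> num_ones c"
  for c :: "bit ^ 'k"
  using num_zeros_plus_num_ones[of c] by linarith

lemma num_ones_set_to_one:
  assumes "Z \<subseteq> {k. c $ k = 0}"
  shows "num_ones (set_to_one Z c) = num_ones c + card Z"
proof -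
  have "{k. set_to_one Z c $ k = 1} = {k. c $ k = 1} \<union> Z"
    by (auto simp: set_to_one_def)
  moreover have "{k. c $ k = 1} \<inter> Z = {}"
    using assms by auto
  ultimately show ?thesis
    unfolding num_ones_def by (simp add: card_Un_disjoint)
qed

text \<open>Each flip adds exactly one 1, so the least number of flips is the gap to the majority
  threshold; truncated subtraction gives 0 once the majority is reached.\<close>

lemma deficit_eq: "deficit c = CARD('k) div 2 + 1 - num_ones c" for c :: "bit ^ 'k"
  unfolding deficit_def
proof (rule Least_equality)
  \<comment> \<open>An empty column would have threshold 1 but no zero to flip.\<close>
  have "0 < CARD('k)" by simp
  then have "CARD('k) div 2 + 1 - num_ones c \<le> card {k. c $ k = 0}"
    using num_zeros_plus_num_ones[of c] unfolding num_zeros_def by linarith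
  then obtain Z where Z: "Z \<subseteq> {k. c $ k = 0}" "card Z = CARD('k) div 2 + 1 - num_ones c"
    by (meson obtain_subset_with_card_n)
  then have "num_zeros (set_to_one Z c) < num_ones (set_to_one Z c)"
    unfolding majority_iff by (simp add: num_ones_set_to_one)
  with Z show "\<exists>Z\<subseteq>{k. c $ k = 0}. card Z = CARD('k) div 2 + 1 - num_ones c \<and>
      num_zeros (set_to_one Z c) < num_ones (set_to_one Z c)"
    by blast
qed (auto simp: majority_iff num_ones_set_to_one)

section \<open>Target 1 and consistency of greedy states\<close>

lemma feasible_one_iff:
  "feasible V 1 S \<longleftrightarrow>
    (\<exists>W. (\<forall>i. i \<notin> S \<longrightarrow> row i W = row i V) \<and>
         (\<forall>j. num_zeros (column j W) < num_ones (column j W)))"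
  unfolding feasible_def by (simp add: one_vec_def) (meson order.asym)

text \<open>The decremented deficits are the true ones, and a chosen voter has no open zeros. Hence
  every open zero is still an entry of the original \<open>V\<close>, which the lower bound on
  feasible sets relies on.\<close>

definition consistent ::
  "bit ^ 'n ^ 'm \<Rightarrow> ('m::finite, 'n::finite) greedy_state \<Rightarrow> bool" where
  "consistent V s \<longleftrightarrow>
    (\<forall>j. deficits s j = deficit (column j (current s))) \<and>
    (\<forall>i. i \<notin> chosen s \<longrightarrow> current s $ i = V $ i) \<and>
    (\<forall>i \<in> chosen s. open_zeros s i = {})"

lemma consistent_init: "consistent V (greedy_init V)"
  by (simp add: consistent_def greedy_init_def)

lemma column_process_voter:
  "column j (current (process_voter i s)) =
    set_to_one (if j \<in> open_zeros s i then {i} else {}) (column j (current s))"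
  by (auto simp: process_voter_def column_def set_to_one_def vec_eq_iff)

lemma consistent_process_voter:
  assumes "consistent V s"
  shows "consistent V (process_voter i s)"
  unfolding consistent_def
proof (intro conjI allI ballI impI)
  fix j
  let ?Z = "if j \<in> open_zeros s i then {i} else {}"
  have "?Z \<subseteq> {k. column j (current s) $ k = 0}"
    by (auto simp: open_zeros_def column_def)
  then have "deficit (column j (current (process_voter i s))) =
      deficit (column j (current s)) - card ?Z"
    by (simp only: column_process_voter deficit_eq num_ones_set_to_one diff_diff_left)
  then show "deficits (process_voter i s) j = deficit (column j (current (process_voter i s)))"
    using assms by (simp add: consistent_def process_voter_def)
next
  fix i' assume "i' \<notin> chosen (process_voter i s)"
  then show "current (process_voter i s) $ i' = V $ i'"
    using assms by (auto simp: consistent_def process_voter_def)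
next
  fix i' assume "i' \<in> chosen (process_voter i s)"
  then have "i' = i \<or> open_zeros s i' = {}"
    using assms by (auto simp: consistent_def process_voter_def)
  \<comment> \<open>Processing only turns zeros into ones and lowers deficits, so no zero ever
    becomes open again.\<close>
  moreover have "open_zeros (process_voter i s) i' \<subseteq> (if i' = i then {} else open_zeros s i')"
    by (auto simp: process_voter_def open_zeros_def set_to_one_def split: if_splits)
  ultimately show "open_zeros (process_voter i s) i' = {}"
    by (auto split: if_splits)
qed

lemma feasible_chosen:
  assumes "consistent V s" "remaining s = 0"
  shows "feasible V 1 (chosen s)"
  unfolding feasible_one_iff
\<comment> \<open>The current matrix is itself the witness: it differs from \<open>V\<close> only in
  chosen rows.\<close>
proof (intro exI[of _ "current s"] conjI allI impI)
  fix j
  have "deficits s j = 0"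
    using assms(2) by (simp add: remaining_def)
  then show "num_zeros (column j (current s)) < num_ones (column j (current s))"
    using assms(1) by (simp add: consistent_def deficit_eq majority_iff)
qed (use assms(1) in \<open>auto simp: consistent_def row_def\<close>)

text \<open>Compared with the current matrix, a bribe of \<open>S\<close> can gain ones in an open
  column only at open zeros of voters in \<open>S\<close>, and it must gain at least the deficit.
  Counting these zeros by column and then by voter gives the bound.\<close>

lemma remaining_le_open_zeros:
  assumes "consistent V s" "feasible V 1 S"
  shows "remaining s \<le> (\<Sum>i\<in>S. card (open_zeros s i))"
proof -
  obtain W where W: "\<And>i. i \<notin> S \<Longrightarrow> row i W = row i V"
    and maj: "\<And>j. CARD('b) div 2 + 1 \<le> num_ones (column j W)"
    using assms(2) by (auto simp: feasible_one_iff majority_iff)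
  have W_eq: "W $ i $ j = V $ i $ j" if "i \<notin> S" for i j
    using W[OF that] by (simp add: row_def vec_eq_iff)
  have "deficits s j \<le> card {i \<in> S. j \<in> open_zeros s i}" for j
  proof (cases "deficits s j = 0")
    case False
    \<comment> \<open>A one of \<open>W\<close> where the current matrix has 0 sits at an open zero,
      so its voter is not chosen and \<open>V\<close> has 0 there too; hence \<open>W\<close>
      changed that row.\<close>
    have "i \<in> {i. current s $ i $ j = 1} \<union> {i \<in> S. j \<in> open_zeros s i}"
      if "W $ i $ j = 1" for i
    proof (cases "current s $ i $ j = 0")
      case True
      then have "j \<in> open_zeros s i"
        using False by (simp add: open_zeros_def)
      then have "i \<notin> chosen s"
        using assms(1) by (auto simp: consistent_def)
      then have "V $ i $ j = 0"
        using assms(1) True by (simp add: consistent_def)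
      then have "i \<in> S"
        using W_eq that by fastforce
      with \<open>j \<in> open_zeros s i\<close> show ?thesis by simp
    qed simp
    then have "num_ones (column j W) \<le> card ({i. current s $ i $ j = 1} \<union> {i \<in> S. j \<in> open_zeros s i})"
      unfolding num_ones_def by (intro card_mono) (auto simp: column_def)
    also have "\<dots> \<le> num_ones (column j (current s)) + card {i \<in> S. j \<in> open_zeros s i}"
      unfolding num_ones_def by (simp add: column_def card_Un_le)
    finally show ?thesis
      using maj[of j] assms(1) by (simp add: consistent_def deficit_eq)
  qed simp
  then have "remaining s \<le> (\<Sum>j\<in>UNIV. card {i \<in> S. j \<in> open_zeros s i})"
    unfolding remaining_def by (intro sum_mono)
  also have "\<dots> = (\<Sum>i\<in>S. card (open_zeros s i))"
    using sum_multicount_gen[of UNIV S "\<lambda>j i. j \<in> open_zeros s i"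
        "\<lambda>i. card (open_zeros s i)"] by simp
  finally show ?thesis .
qed

section \<open>Progress and price of a greedy choice\<close>

lemma feasible_UNIV: "feasible V 1 UNIV"
  unfolding feasible_one_iff
  by (rule exI[of _ 1]) (simp add: num_zeros_def num_ones_def column_def)

lemma minimizers_nonempty: "minimizers price s \<noteq> {}"
proof -
  obtain i where "is_arg_min (price_ratio price s) (\<lambda>i. i \<in> UNIV) i"
    using ex_is_arg_min_if_finite[of UNIV "price_ratio price s"] by auto
  then show ?thesis
    by (auto simp: minimizers_def is_arg_min_linorder)
qed

text \<open>If the least ratio were infinite, no voter would have an open zero, and the lower bound
  for the feasible set of all voters would force \<open>remaining s = 0\<close>.\<close>

lemma open_zeros_minimizer_nonempty:
  assumes "consistent V s" "remaining s \<noteq> 0" "i \<in> minimizers price s"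
  shows "open_zeros s i \<noteq> {}"
proof
  assume "open_zeros s i = {}"
  then have "price_ratio price s i' = \<infinity>" for i'
    using assms(3) by (auto simp: minimizers_def price_ratio_def split: if_splits)
  then have "card (open_zeros s i') = 0" for i'
    by (metis PInfty_neq_ereal(1) price_ratio_def)
  then show False
    using remaining_le_open_zeros[OF assms(1) feasible_UNIV] assms(2) by simp
qed

text \<open>Open zeros lie in columns of positive deficit, so the truncated decrement there loses
  exactly 1.\<close>

lemma remaining_process_voter:
  "remaining (process_voter i s) + card (open_zeros s i) = remaining s"
proof -
  have "remaining s =
      (\<Sum>j\<in>UNIV. deficits (process_voter i s) j + (if j \<in> open_zeros s i then 1 else 0))"
    unfolding remaining_def
    by (intro sum.cong) (auto simp: process_voter_def open_zeros_def)
  then show ?thesis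
    by (simp add: sum.distrib remaining_def flip: sum.inter_filter)
qed

lemma minimizer_price_le:
  assumes "consistent V s" "remaining s \<noteq> 0" "i \<in> minimizers price s"
    and "\<And>i. price i \<ge> 0" "feasible V 1 S"
  shows "real_of_rat (price i) * real (remaining s)
    \<le> real (card (open_zeros s i)) * real_of_rat (total_price price S)"
proof -
  let ?k = "\<lambda>i. real (card (open_zeros s i))"
  let ?p = "\<lambda>i. real_of_rat (price i)"
  have k: "?k i > 0"
    using open_zeros_minimizer_nonempty[OF assms(1-3)] by (simp add: card_gt_0_iff)
  \<comment> \<open>Cross-multiplied, minimality also covers voters of infinite ratio: the left side
    is then 0 and prices are nonnegative.\<close>
  have ratio: "?p i * ?k i' \<le> ?k i * ?p i'" for i'
  proof (cases "?k i' = 0")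
    case True
    then show ?thesis
      using assms(4) by simp
  next
    case False
    have "price_ratio price s i \<le> price_ratio price s i'"
      using assms(3) by (simp add: minimizers_def)
    then have "?p i / ?k i \<le> ?p i' / ?k i'"
      using k False by (simp add: price_ratio_def split: if_splits)
    then show ?thesis
      using k False by (simp add: field_simps)
  qed
  have "?p i * real (remaining s) \<le> ?p i * real (\<Sum>i\<in>S. card (open_zeros s i))"
    using remaining_le_open_zeros[OF assms(1,5)] assms(4)
    by (intro mult_left_mono) (simp_all only: of_nat_le_iff zero_le_of_rat_iff)
  also have "\<dots> = (\<Sum>i'\<in>S. ?p i * ?k i')"
    by (simp add: sum_distrib_left)
  also have "\<dots> \<le> (\<Sum>i'\<in>S. ?k i * ?p i')"
    by (intro sum_mono ratio)
  finally show ?thesis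
    by (simp add: total_price_def of_rat_sum sum_distrib_left)
qed

section \<open>Harmonic numbers and the cost of a run\<close>

lemma harm_add_ge: "harm a + real k / real (a + k) \<le> harm (a + k)"
proof (induction k)
  case (Suc k)
  \<comment> \<open>Enlarging the denominator only lowers the old fraction; the missing
    \<open>1 / (a + k + 1)\<close> is the new harmonic term. For \<open>a + k = 0\<close> both sides
    are 0.\<close>
  have "real k / real (a + k + 1) \<le> real k / real (a + k)"
    by (cases "a + k = 0") (auto intro!: divide_left_mono)
  with Suc show ?case
    by (simp add: harm_Suc add_divide_distrib inverse_eq_divide)
qed simp

text \<open>The sequence \<open>harm (Suc k) - ln (Suc k)\<close> decreases from its value 1 at
  \<open>k = 0\<close>.\<close>

lemma harm_le_ln: "harm n \<le> 1 + ln (real n)" if "n \<noteq> 0"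
proof -
  obtain k where "n = Suc k"
    using \<open>n \<noteq> 0\<close> not0_implies_Suc by blast
  then show ?thesis
    using decseqD[OF decseq_harm_diff_ln, of 0 k] by (simp add: harm_expand(2))
qed

text \<open>The harmonic difference is 0 at the start and \<open>harm (total_deficit V)\<close> when
  nothing remains. Comparing with every feasible \<open>S\<close> leaves the choice of an optimal
  one to the end.\<close>

definition greedy_invariant ::
  "('m \<Rightarrow> rat) \<Rightarrow> bit ^ 'n ^ 'm \<Rightarrow> ('m::finite, 'n::finite) greedy_state \<Rightarrow> bool" where
  "greedy_invariant price V s \<longleftrightarrow> consistent V s \<and>
    (\<forall>S. feasible V 1 S \<longrightarrow>
      real_of_rat (total_price price (chosen s))
        \<le> (harm (total_deficit V) - harm (remaining s)) * real_of_rat (total_price price S))"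

lemma greedy_invariant_init: "greedy_invariant price V (greedy_init V)"
  by (simp add: greedy_invariant_def consistent_init)
    (simp add: greedy_init_def remaining_def total_deficit_def total_price_def)

lemma greedy_invariant_process_voter:
  assumes inv: "greedy_invariant price V s" and rem: "remaining s \<noteq> 0"
    and i: "i \<in> minimizers price s" and nonneg: "\<And>i. price i \<ge> 0"
  shows "greedy_invariant price V (process_voter i s)"
  unfolding greedy_invariant_def
proof (intro conjI allI impI)
  have con: "consistent V s"
    using inv by (simp add: greedy_invariant_def)
  then show "consistent V (process_voter i s)"
    by (rule consistent_process_voter)
  fix S assume S: "feasible V 1 S"
  let ?s' = "process_voter i s"
  let ?P = "real_of_rat (total_price price S)"
  have P: "0 \<le> ?P"
    using nonneg by (simp add: total_price_def sum_nonneg)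
  \<comment> \<open>Only an inequality: \<open>insert\<close> changes nothing for a voter already
    chosen, and then nonnegativity of the price suffices.\<close>
  have "total_price price (chosen ?s') \<le> price i + total_price price (chosen s)"
    using nonneg by (simp add: process_voter_def total_price_def sum.insert_if)
  then have "real_of_rat (total_price price (chosen ?s'))
      \<le> real_of_rat (price i) + real_of_rat (total_price price (chosen s))"
    by (metis of_rat_add of_rat_less_eq)
  also have "real_of_rat (price i) \<le> card (open_zeros s i) / remaining s * ?P"
    using minimizer_price_le[OF con rem i nonneg S] rem by (simp add: field_simps)
  \<comment> \<open>Each harmonic term between the new and the old remaining deficit is at least
    \<open>1 / remaining s\<close>.\<close>
  also have "\<dots> \<le> (harm (remaining s) - harm (remaining ?s')) * ?P"
    using harm_add_ge[of "remaining ?s'" "card (open_zeros s i)"] P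
    by (intro mult_right_mono) (simp_all add: remaining_process_voter)
  also have "real_of_rat (total_price price (chosen s))
      \<le> (harm (total_deficit V) - harm (remaining s)) * ?P"
    using inv S by (simp add: greedy_invariant_def)
  finally show "real_of_rat (total_price price (chosen ?s'))
      \<le> (harm (total_deficit V) - harm (remaining ?s')) * ?P"
    by (simp add: algebra_simps)
qed

text \<open>Every minimizer has an open zero while deficit remains, so \<open>remaining\<close> is a
  termination measure under the invariant, which then carries over to the final state.\<close>

lemma greedy_result:
  assumes nonneg: "\<And>i. price i \<ge> 0" and tie: "\<And>s C. C \<noteq> {} \<Longrightarrow> tie s C \<in> C"
  obtains s where "greedy tie price V = Some (chosen s)"
    and "greedy_invariant price V s" and "remaining s = 0"
proof -
  let ?step = "\<lambda>s. process_voter (tie s (minimizers price s)) s"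
  let ?loop = "while_option (\<lambda>s. remaining s \<noteq> 0) ?step (greedy_init V)"
  have min: "tie s (minimizers price s) \<in> minimizers price s" for s
    by (intro tie minimizers_nonempty)
  have step: "greedy_invariant price V (?step s)"
    if "greedy_invariant price V s" "remaining s \<noteq> 0" for s
    by (rule greedy_invariant_process_voter[OF that min nonneg])
  have less: "remaining (?step s) < remaining s"
    if "greedy_invariant price V s" "remaining s \<noteq> 0" for s
  proof -
    have "open_zeros s (tie s (minimizers price s)) \<noteq> {}"
      using that(1) open_zeros_minimizer_nonempty[of V s, OF _ that(2) min]
      by (simp add: greedy_invariant_def)
    then have "0 < card (open_zeros s (tie s (minimizers price s)))"
      by (simp add: card_gt_0_iff)
    then show ?thesis
      using remaining_process_voter[of "tie s (minimizers price s)" s] by linarith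
  qed
  have "\<exists>t. ?loop = Some t"
    by (rule measure_while_option_Some[of "greedy_invariant price V" _ ?step remaining])
      (simp_all only: step less greedy_invariant_init simp_thms)
  then obtain t where t: "?loop = Some t"
    by (elim exE)
  show ?thesis
  proof
    show "greedy tie price V = Some (chosen t)"
      using t by (simp add: greedy_def)
    show "greedy_invariant price V t"
      by (rule while_option_rule[OF step t greedy_invariant_init])
    show "remaining t = 0"
      using while_option_stop[OF t] by simp
  qed
qed

section \<open>The optimum and the explicit bounds\<close>

lemma OPT_attained:
  obtains S where "feasible V 1 S" "OPT V 1 price = total_price price S"
proof -
  \<comment> \<open>\<open>Min\<close> needs a nonempty set, supplied by bribing all voters.\<close>
  have "OPT V 1 price \<in> total_price price ` {S. feasible V 1 S}"
    unfolding OPT_def using feasible_UNIV by (intro Min_in) auto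
  then show ?thesis
    using that by blast
qed

lemma total_deficit_le:
  "total_deficit V \<le> CARD('n) * (CARD('m) div 2 + 1)" for V :: "bit ^ 'n ^ 'm"
  unfolding total_deficit_def
  using sum_bounded_above[of UNIV "\<lambda>j. deficit (column j V)" "CARD('m) div 2 + 1"]
  by (simp add: deficit_eq)

text \<open>Links the ceiling in the stated bound to the majority threshold of a column of length
  \<open>m\<close>.\<close>

lemma ceiling_half_Suc: "\<lceil>(real m + 1) / 2\<rceil> = int (m div 2 + 1)"
  by (cases "even m") (auto elim!: evenE oddE intro!: ceiling_unique)

theorem theorem2p2:
  fixes V :: "bit ^ 'n ^ 'm"
    and price :: "'m \<Rightarrow> rat"
    and tie :: "('m, 'n) greedy_state \<Rightarrow> 'm set \<Rightarrow> 'm"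
  assumes price_nonneg: "\<And>i. price i \<ge> 0"
    and tie: "\<And>s C. C \<noteq> {} \<Longrightarrow> tie s C \<in> C"
  shows "(\<exists>X. greedy tie price V = Some X \<and> feasible V 1 X \<and>
            real_of_rat (total_price price X)
              \<le> (\<Sum>i=1..total_deficit V. 1 / real i) * real_of_rat (OPT V 1 price)) \<and>
         (\<Sum>i=1..total_deficit V. 1 / real i) \<le> 1 + ln (real (total_deficit V)) \<and>
         1 + ln (real (total_deficit V))
           \<le> 1 + ln (real CARD('n) * real_of_int \<lceil>(real CARD('m) + 1) / 2\<rceil>)"
proof (intro conjI)
  have harm: "(\<Sum>i=1..total_deficit V. 1 / real i) = harm (total_deficit V)"
    by (simp add: harm_def inverse_eq_divide)
  obtain s where s: "greedy tie price V = Some (chosen s)" "greedy_invariant price V s"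
    and rem: "remaining s = 0"
    using greedy_result[of price tie V] price_nonneg tie by blast
  obtain S where S: "feasible V 1 S" "OPT V 1 price = total_price price S"
    by (rule OPT_attained)
  have "feasible V 1 (chosen s)"
    using s(2) rem by (intro feasible_chosen) (simp_all add: greedy_invariant_def)
  moreover have "real_of_rat (total_price price (chosen s))
      \<le> harm (total_deficit V) * real_of_rat (OPT V 1 price)"
    using s(2) S rem by (auto simp: greedy_invariant_def harm_expand)
  ultimately show "\<exists>X. greedy tie price V = Some X \<and> feasible V 1 X \<and>
      real_of_rat (total_price price X)
        \<le> (\<Sum>i=1..total_deficit V. 1 / real i) * real_of_rat (OPT V 1 price)"
    using s(1) harm by auto
  show "(\<Sum>i=1..total_deficit V. 1 / real i) \<le> 1 + ln (real (total_deficit V))"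
    unfolding harm
    using harm_le_ln[of "total_deficit V"]
    \<comment> \<open>For total deficit 0 the sum is empty and \<open>ln 0 = 0\<close>, so the claim
      reads \<open>0 \<le> 1\<close>.\<close>
    by (cases "total_deficit V = 0") (simp_all add: harm_expand(1))
  have le: "real (total_deficit V) \<le> real CARD('n) * real_of_int \<lceil>(real CARD('m) + 1) / 2\<rceil>"
    using of_nat_mono[OF total_deficit_le[of V], where 'a = real]
    unfolding ceiling_half_Suc of_int_of_nat_eq of_nat_mult .
  show "1 + ln (real (total_deficit V))
      \<le> 1 + ln (real CARD('n) * real_of_int \<lceil>(real CARD('m) + 1) / 2\<rceil>)"
  proof (cases "total_deficit V = 0")
    case True
    \<comment> \<open>Monotonicity of \<open>ln\<close> is applied only to positive arguments. Here
      \<open>ln 0 = 0\<close>, and the argument on the right is at least 1, so its logarithm is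
      nonnegative.\<close>
    have "1 \<le> CARD('n) * (CARD('m) div 2 + 1)"
      by (simp add: Suc_le_eq del: mult_Suc_right)
    then have "1 \<le> real CARD('n) * real (CARD('m) div 2 + 1)"
      by (metis of_nat_1 of_nat_le_iff of_nat_mult)
    then show ?thesis
      unfolding ceiling_half_Suc of_int_of_nat_eq True by (simp del: of_nat_add of_nat_Suc)
  next
    case False
    then show ?thesis
      using le by (intro add_left_mono ln_mono) simp_all
  qed
qed

end
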